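(* There exists a diversity on a set of four elements that is not Minkowski-embeddable.
   Context: A convex body in $\mathbb{R}^d$ is a compact, convex set with non-empty interior. For a convex body $K$ in $\mathbb{R}^d$ and bounded $A \subseteq \mathbb{R}^d$, the generalized circumradius of $A$ with respect to $K$ is \[R(A,K) = \inf\{\lambda \ge 0 : A \subseteq \lambda K+x \mbox{ for some } x \in \mathbb{R}^d\}.\] A diversity is a pair $(X,\delta)$ where $X$ is a set and $\delta$ is a function from the finite subsets of $X$ to $\mathbb{R}_{\geq 0}$ such that, for all finite $A,B,C \subseteq X$: (D1) $\delta(A)=0$ if and only if $|A| \leq 1$; (D2) if $B \neq \emptyset$ then $\delta(A \cup C) \leq \delta(A \cup B) + \delta(B \cup C)$. A diversity $(X,\delta)$ is Minkowski-embeddable if for some $d$ there is a map $\phi:X \rightarrow \mathbb{R}^d$ and a convex body $K$ in $\mathbb{R}^d$ such that $\delta(A) = R(\phi(A),K)$ for all finite $A \subseteq X$. *)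

theory Defs
  imports "HOL-Analysis.Analysis"
begin

text \<open>
  The dimension \<open>d\<close> is quantified inside the definition of Minkowski embeddability, so \<open>\<real>\<^sup>d\<close> cannot
  be rendered by a type. It is the topological space \<^const>\<open>Euclidean_space\<close> \<open>d\<close>, whose points are
  the functions \<open>nat \<Rightarrow> real\<close> vanishing at all indices \<open>\<ge> d\<close>. As \<open>nat \<Rightarrow> real\<close> is not an instance of
  \<open>real_vector\<close>, linear operations are written coordinatewise.
\<close>

definition convex_body :: "nat \<Rightarrow> (nat \<Rightarrow> real) set \<Rightarrow> bool" where
  "convex_body d K \<longleftrightarrow>
     compactin (Euclidean_space d) K \<and>
     (\<forall>x\<in>K. \<forall>y\<in>K. \<forall>u\<ge>0. \<forall>v\<ge>0. u + v = 1 \<longrightarrow> (\<lambda>i. u * x i + v * y i) \<in> K) \<and>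
     Euclidean_space d interior_of K \<noteq> {}"

definition scale_translate :: "real \<Rightarrow> (nat \<Rightarrow> real) set \<Rightarrow> (nat \<Rightarrow> real) \<Rightarrow> (nat \<Rightarrow> real) set" where
  "scale_translate l K x = (\<lambda>k i. l * k i + x i) ` K"

text \<open>
  If \<open>K\<close> is a convex body and \<open>A\<close> is bounded, the set below is nonempty and bounded below by \<open>0\<close>,
  so the conditionally complete \<^const>\<open>Inf\<close> on the reals is the true infimum.
\<close>

definition circumradius :: "nat \<Rightarrow> (nat \<Rightarrow> real) set \<Rightarrow> (nat \<Rightarrow> real) set \<Rightarrow> real" where
  "circumradius d A K =
     Inf {l. 0 \<le> l \<and> (\<exists>x \<in> topspace (Euclidean_space d). A \<subseteq> scale_translate l K x)}"

text \<open>Only the values of \<open>\<delta>\<close> on finite subsets of \<open>X\<close> are relevant.\<close>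

definition diversity :: "'a set \<Rightarrow> ('a set \<Rightarrow> real) \<Rightarrow> bool" where
  "diversity X \<delta> \<longleftrightarrow>
     (\<forall>A. finite A \<and> A \<subseteq> X \<longrightarrow> 0 \<le> \<delta> A) \<and>
     (\<forall>A. finite A \<and> A \<subseteq> X \<longrightarrow> (\<delta> A = 0 \<longleftrightarrow> card A \<le> 1)) \<and>
     (\<forall>A B C. finite A \<and> A \<subseteq> X \<and> finite B \<and> B \<subseteq> X \<and> finite C \<and> C \<subseteq> X \<and> B \<noteq> {} \<longrightarrow>
        \<delta> (A \<union> C) \<le> \<delta> (A \<union> B) + \<delta> (B \<union> C))"

definition Minkowski_embeddable :: "'a set \<Rightarrow> ('a set \<Rightarrow> real) \<Rightarrow> bool" where
  "Minkowski_embeddable X \<delta> \<longleftrightarrow>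
     (\<exists>d \<phi> K. \<phi> \<in> X \<rightarrow> topspace (Euclidean_space d) \<and> convex_body d K \<and>
        (\<forall>A. finite A \<and> A \<subseteq> X \<longrightarrow> \<delta> A = circumradius d (\<phi> ` A) K))"

end

theory Submission
  imports Defs
begin

text \<open>
  Let \<open>p\<^sub>1, \<dots>, p\<^sub>n\<close> be points with sum \<open>s\<close>, and let \<open>F\<^sub>j\<close> be the set of all of them except \<open>p\<^sub>j\<close>.
  Adding up \<open>p\<^sub>i \<in> F\<^sub>j\<close> for \<open>j \<noteq> i\<close> and the centroid of \<open>F\<^sub>i\<close> gives
  \<open>(n (n - 2) / (n - 1)) p\<^sub>i + s / (n - 1)\<close>, so a translate of \<open>n (n - 2) / (n - 1)\<close> times the
  whole set lies in the Minkowski sum of the convex hulls of the \<open>F\<^sub>j\<close>. Hence its circumradius is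
  at most \<open>(n - 1) / (n (n - 2))\<close> times the sum of the circumradii of the \<open>F\<^sub>j\<close>. For \<open>n = 4\<close> with
  all \<open>F\<^sub>j\<close> of circumradius \<open>1\<close> this bound is \<open>3/2\<close>, whereas the diversity axioms allow \<open>2\<close>.
\<close>

text \<open>Normalising the weights turns each induction step into a convex combination of two
  points. If the total weight is zero, \<open>k a\<close> serves as \<open>q\<close>; stating the
  result as total weight times \<open>q\<close> instead of a quotient covers this case too.\<close>

lemma weighted_sum_in_scaled_convex:
  fixes K :: "('b \<Rightarrow> real) set"
  assumes conv: "\<forall>x\<in>K. \<forall>y\<in>K. \<forall>u\<ge>0. \<forall>v\<ge>0. u + v = 1 \<longrightarrow> (\<lambda>i. u * x i + v * y i) \<in> K"
    and "finite J" "J \<noteq> {}" "\<And>j. j \<in> J \<Longrightarrow> 0 \<le> w j" "\<And>j. j \<in> J \<Longrightarrow> k j \<in> K"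
  shows "\<exists>q\<in>K. \<forall>m. (\<Sum>j\<in>J. w j * k j m) = (\<Sum>j\<in>J. w j) * q m"
  using assms(2-)
proof (induction J rule: finite_ne_induct)
  case (singleton a)
  then show ?case by auto
next
  case (insert a J)
  then obtain q where q: "q \<in> K" "\<And>m. (\<Sum>j\<in>J. w j * k j m) = sum w J * q m"
    by auto
  have ka: "k a \<in> K" and wa: "0 \<le> w a" and wJ: "0 \<le> sum w J"
    using insert.prems by (auto intro: sum_nonneg)
  show ?case
  proof (cases "w a + sum w J = 0")
    case True
    then have "w a = 0" "sum w J = 0"
      using wa wJ by linarith+
    then show ?thesis
      using insert.hyps q ka by (intro bexI[of _ "k a"]) auto
  next
    case False
    define W where "W = w a + sum w J"
    have W: "W > 0"
      using False wa wJ by (simp add: W_def)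
    define r where "r = (\<lambda>m. w a / W * k a m + sum w J / W * q m)"
    have "w a / W + sum w J / W = 1"
      using W by (simp add: W_def flip: add_divide_distrib)
    then have "r \<in> K"
      unfolding r_def using wa wJ W by (intro conv[rule_format] ka q(1)) auto
    moreover have "W * r m = w a * k a m + sum w J * q m" for m
      using W by (simp add: r_def distrib_left)
    ultimately show ?thesis
      using insert.hyps q(2) by (intro bexI[of _ r]) (auto simp: W_def)
  qed
qed

text \<open>The translation vector comes from solving the summed identity for
  \<open>\<phi> i\<close>. It depends only on the centres \<open>x j\<close> and the total of all
  \<open>\<phi> j\<close>, so one vector serves every \<open>i\<close>.\<close>

lemma cover_from_facet_covers:
  fixes \<phi> x :: "'a \<Rightarrow> nat \<Rightarrow> real"
  assumes conv: "\<forall>x\<in>K. \<forall>y\<in>K. \<forall>u\<ge>0. \<forall>v\<ge>0. u + v = 1 \<longrightarrow> (\<lambda>i. u * x i + v * y i) \<in> K"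
    and fin: "finite I" and n: "card I = n" "n \<ge> 3"
    and l: "\<And>j. j \<in> I \<Longrightarrow> 0 \<le> l j"
    and cover: "\<And>j. j \<in> I \<Longrightarrow> \<phi> ` (I - {j}) \<subseteq> scale_translate (l j) K (x j)"
  defines "c \<equiv> (real n - 1) / (real n * (real n - 2))"
  shows "\<phi> ` I \<subseteq> scale_translate (c * sum l I) K
           (\<lambda>m. c * ((\<Sum>j\<in>I. x j m) - (\<Sum>j\<in>I. \<phi> j m) / (real n - 1)))"
proof
  fix p assume "p \<in> \<phi> ` I"
  then obtain i where i: "i \<in> I" and p: "p = \<phi> i" by auto
  \<comment> \<open>The membership conditions sit inside the existential so that choice yields a
    total \<open>k\<close>; \<open>k a j\<close> is the point of \<open>K\<close> that represents
    \<open>\<phi> a\<close> in the cover omitting \<open>j\<close>.\<close>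
  have "\<forall>a j. \<exists>q. j \<in> I \<and> a \<in> I - {j} \<longrightarrow> q \<in> K \<and> (\<forall>m. \<phi> a m = l j * q m + x j m)"
  proof (intro allI)
    fix a j
    have "\<phi> a \<in> scale_translate (l j) K (x j)" if "j \<in> I" "a \<in> I - {j}"
      using cover[OF that(1)] that(2) by blast
    then show "\<exists>q. j \<in> I \<and> a \<in> I - {j} \<longrightarrow> q \<in> K \<and> (\<forall>m. \<phi> a m = l j * q m + x j m)"
      by (cases "j \<in> I \<and> a \<in> I - {j}") (auto simp: scale_translate_def)
  qed
  then obtain k where "\<forall>a j. j \<in> I \<and> a \<in> I - {j} \<longrightarrow>
      k a j \<in> K \<and> (\<forall>m. \<phi> a m = l j * k a j m + x j m)"
    unfolding choice_iff by (elim exE)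
  then have kK: "\<And>a j. j \<in> I \<Longrightarrow> a \<in> I - {j} \<Longrightarrow> k a j \<in> K"
    and k: "\<And>a j m. j \<in> I \<Longrightarrow> a \<in> I - {j} \<Longrightarrow> \<phi> a m = l j * k a j m + x j m"
    by auto
  have cI: "real (card (I - {i})) = real n - 1"
    using i fin n by (simp add: of_nat_diff)
  have "I - {i} \<noteq> {}"
    using cI n by force
  then obtain b where b: "b \<in> K" "\<And>m. (\<Sum>a\<in>I - {i}. k a i m) = (real n - 1) * b m"
    using weighted_sum_in_scaled_convex[OF conv, of "I - {i}" "\<lambda>_. 1" "\<lambda>a. k a i"] fin i kK cI
    by auto
  \<comment> \<open>\<open>h j\<close> represents the summand taken from the \<open>j\<close>-th
    set: \<open>\<phi> i\<close> itself for \<open>j \<noteq> i\<close>, and for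
    \<open>j = i\<close> the centroid of the points other than \<open>\<phi> i\<close>, which
    \<open>b\<close> represents.\<close>
  define h where "h = (k i)(i := b)"
  have "h j \<in> K" if "j \<in> I" for j
    using that b(1) kK[of j i] i by (auto simp: h_def)
  then obtain q where q: "q \<in> K" "\<And>m. (\<Sum>j\<in>I. l j * h j m) = sum l I * q m"
    using weighted_sum_in_scaled_convex[OF conv fin, of l h] l i by auto
  have "\<phi> i m = c * sum l I * q m + c * ((\<Sum>j\<in>I. x j m) - (\<Sum>j\<in>I. \<phi> j m) / (real n - 1))" for m
  proof -
    define s where "s = (\<Sum>j\<in>I. \<phi> j m)"
    have "(\<Sum>j\<in>I - {i}. l j * h j m + x j m) = (\<Sum>j\<in>I - {i}. \<phi> i m)"
      using i by (intro sum.cong) (auto simp: h_def k)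
    then have A: "(\<Sum>j\<in>I - {i}. l j * h j m + x j m) = (real n - 1) * \<phi> i m"
      using cI by simp
    \<comment> \<open>Averaging the covers of the points other than \<open>\<phi> i\<close> shows
      that \<open>b\<close> is carried to their centroid, \<open>(s - \<phi> i m) / (n - 1)\<close>
      in coordinate \<open>m\<close>.\<close>
    have "s - \<phi> i m = (\<Sum>a\<in>I - {i}. l i * k a i m + x i m)"
      unfolding s_def using i fin k by (simp add: sum.remove[of I i])
    also have "\<dots> = (real n - 1) * (l i * b m + x i m)"
      by (simp only: sum.distrib sum_constant cI b(2) distrib_left mult.left_commute
          flip: sum_distrib_left)
    finally have B: "l i * h i m + x i m = (s - \<phi> i m) / (real n - 1)"
      using n by (simp add: h_def field_simps)
    have "sum l I * q m + (\<Sum>j\<in>I. x j m) = (\<Sum>j\<in>I. l j * h j m + x j m)"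
      by (simp add: sum.distrib q(2))
    also have "\<dots> = (real n - 1) * \<phi> i m + (s - \<phi> i m) / (real n - 1)"
      using A B i fin by (simp add: sum.remove[of I i])
    finally have C: "sum l I * q m + (\<Sum>j\<in>I. x j m) - s / (real n - 1)
        = ((real n - 1) - 1 / (real n - 1)) * \<phi> i m"
      by (simp add: algebra_simps diff_divide_distrib)
    \<comment> \<open>\<open>c\<close> is chosen as the inverse of the coefficient of
      \<open>\<phi> i\<close> in \<open>C\<close>.\<close>
    have "c * ((real n - 1) - 1 / (real n - 1)) = 1"
    proof -
      have "(real n - 1) - 1 / (real n - 1) = real n * (real n - 2) / (real n - 1)"
        using n by (simp add: field_simps)
      then show ?thesis
        using n by (simp add: c_def)
    qed
    then have "\<phi> i m = c * (sum l I * q m + (\<Sum>j\<in>I. x j m) - s / (real n - 1))"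
      unfolding C by (simp flip: mult.assoc)
    then show ?thesis
      by (simp add: s_def algebra_simps)
  qed
  then show "p \<in> scale_translate (c * sum l I) K
      (\<lambda>m. c * ((\<Sum>j\<in>I. x j m) - (\<Sum>j\<in>I. \<phi> j m) / (real n - 1)))"
    unfolding scale_translate_def p using q(1) by blast
qed

lemma circumradius_lower:
  assumes "0 \<le> l" "x \<in> topspace (Euclidean_space d)" "A \<subseteq> scale_translate l K x"
  shows "circumradius d A K \<le> l"
  unfolding circumradius_def using assms by (intro cInf_lower bdd_belowI[of _ 0]) auto

text \<open>Covers with factors within \<open>e'\<close> of the infima are combined, and then
  \<open>e\<close> tends to 0. The assumption \<open>coverable\<close> keeps each infimum off the
  empty set, so that such covers exist.\<close>

lemma circumradius_le_facets:
  fixes \<phi> :: "'a \<Rightarrow> nat \<Rightarrow> real"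
  assumes conv: "\<forall>x\<in>K. \<forall>y\<in>K. \<forall>u\<ge>0. \<forall>v\<ge>0. u + v = 1 \<longrightarrow> (\<lambda>i. u * x i + v * y i) \<in> K"
    and fin: "finite I" and n: "card I = n" "n \<ge> 3"
    and \<phi>: "\<phi> \<in> I \<rightarrow> topspace (Euclidean_space d)"
    and coverable: "\<And>j. j \<in> I \<Longrightarrow> \<exists>l\<ge>0. \<exists>x\<in>topspace (Euclidean_space d).
           \<phi> ` (I - {j}) \<subseteq> scale_translate l K x"
  shows "circumradius d (\<phi> ` I) K
         \<le> (real n - 1) / (real n * (real n - 2)) * (\<Sum>j\<in>I. circumradius d (\<phi> ` (I - {j})) K)"
proof -
  define c where "c = (real n - 1) / (real n * (real n - 2))"
  have c: "c > 0"
    using n by (simp add: c_def)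
  define R where "R = (\<lambda>j. circumradius d (\<phi> ` (I - {j})) K)"
  have "circumradius d (\<phi> ` I) K \<le> c * sum R I + e" if "e > 0" for e
  proof -
    \<comment> \<open>The \<open>n\<close> slacks, scaled by \<open>c\<close>, add up to exactly
      \<open>e\<close>.\<close>
    define e' where "e' = e / (c * real n)"
    have e': "e' > 0"
      using that c n by (simp add: e'_def)
    have "\<exists>l x. 0 \<le> l \<and> l < R j + e' \<and> x \<in> topspace (Euclidean_space d) \<and>
        \<phi> ` (I - {j}) \<subseteq> scale_translate l K x" if "j \<in> I" for j
    proof -
      let ?S = "{l. 0 \<le> l \<and> (\<exists>x \<in> topspace (Euclidean_space d).
        \<phi> ` (I - {j}) \<subseteq> scale_translate l K x)}"
      have "?S \<noteq> {}"
        using coverable[OF that] by blast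
      moreover have "Inf ?S < R j + e'"
        using e' by (simp add: R_def circumradius_def)
      ultimately have "\<exists>l\<in>?S. l < R j + e'"
        by (intro cInf_lessD) auto
      then show ?thesis by blast
    qed
    then obtain l x where l: "\<And>j. j \<in> I \<Longrightarrow> 0 \<le> l j" "\<And>j. j \<in> I \<Longrightarrow> l j < R j + e'"
      and x: "\<And>j. j \<in> I \<Longrightarrow> x j \<in> topspace (Euclidean_space d)"
      and cov: "\<And>j. j \<in> I \<Longrightarrow> \<phi> ` (I - {j}) \<subseteq> scale_translate (l j) K (x j)"
      by metis
    have "circumradius d (\<phi> ` I) K \<le> c * sum l I"
    proof (rule circumradius_lower)
      show "0 \<le> c * sum l I"
        using c l(1) by (simp add: sum_nonneg)
      show "\<phi> ` I \<subseteq> scale_translate (c * sum l I) K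
           (\<lambda>m. c * ((\<Sum>j\<in>I. x j m) - (\<Sum>j\<in>I. \<phi> j m) / (real n - 1)))"
        unfolding c_def by (rule cover_from_facet_covers[OF conv fin n l(1) cov])
      show "(\<lambda>m. c * ((\<Sum>j\<in>I. x j m) - (\<Sum>j\<in>I. \<phi> j m) / (real n - 1)))
          \<in> topspace (Euclidean_space d)"
        using x \<phi> by (auto simp: topspace_Euclidean_space Pi_iff)
    qed
    also have "sum l I \<le> (\<Sum>j\<in>I. R j + e')"
      using l(2) by (intro sum_mono) (simp add: less_imp_le)
    also have "c * (\<Sum>j\<in>I. R j + e') = c * sum R I + e"
      using c n by (simp add: sum.distrib e'_def distrib_left)
    finally show ?thesis
      using c by simp
  qed
  then show ?thesis
    unfolding c_def R_def by (rule field_le_epsilon)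
qed

text \<open>If both terms on the right of the triangle inequality are nonzero, they add up to at
  least 2, the largest value. If one is zero, say that of \<open>A \<union> B\<close>, then
  \<open>B\<close> is a singleton containing \<open>A\<close>, and monotonicity suffices.\<close>

lemma diversity_of_card_four:
  assumes "card X = 4"
  shows "diversity X (\<lambda>A. if card A \<le> 1 then 0 else if card A \<le> 3 then 1 else 2)"
proof -
  let ?\<delta> = "\<lambda>A. if card A \<le> 1 then 0 else if card A \<le> 3 then 1 else (2::real)"
  have mono: "?\<delta> A \<le> ?\<delta> B" if "A \<subseteq> B" "finite B" for A B :: "'a set"
    using card_mono[OF that(2,1)] by auto
  have "?\<delta> (A \<union> C) \<le> ?\<delta> (A \<union> B) + ?\<delta> (B \<union> C)"
    if fin: "finite A" "finite B" "finite C" and B: "B \<noteq> {}" for A B C :: "'a set"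
  proof -
    have sub: "D \<subseteq> B" if "card (B \<union> D) \<le> 1" "finite D" for D
    proof -
      have "card B \<ge> 1"
        using B fin by (simp add: Suc_leI card_gt_0_iff)
      then have "B = B \<union> D"
        using that fin by (intro card_seteq) auto
      then show ?thesis by blast
    qed
    consider "card (A \<union> B) \<le> 1" | "card (B \<union> C) \<le> 1" | "card (A \<union> B) > 1" "card (B \<union> C) > 1"
      by linarith
    then show ?thesis
    proof cases
      case 1
      then have "A \<union> C \<subseteq> B \<union> C"
        using sub[of A] fin by (auto simp: Un_commute)
      from mono[OF this] show ?thesis
        using fin 1 by auto
    next
      case 2
      then have "A \<union> C \<subseteq> A \<union> B"
        using sub[of C] fin by auto
      from mono[OF this] show ?thesis
        using fin 2 by auto
    next
      case 3
      then show ?thesis by auto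
    qed
  qed
  then show ?thesis
    unfolding diversity_def by auto
qed

theorem corollary15:
  shows "\<exists>(X :: nat set) (\<delta> :: nat set \<Rightarrow> real).
           card X = 4 \<and> diversity X \<delta> \<and> \<not> Minkowski_embeddable X \<delta>"
proof -
  define X :: "nat set" where "X = {..<4}"
  define \<delta> :: "nat set \<Rightarrow> real" where
    "\<delta> = (\<lambda>A. if card A \<le> 1 then 0 else if card A \<le> 3 then 1 else 2)"
  have X: "card X = 4" "finite X"
    by (auto simp: X_def)
  have "\<not> Minkowski_embeddable X \<delta>"
  proof
    assume "Minkowski_embeddable X \<delta>"
    then obtain d \<phi> K where \<phi>: "\<phi> \<in> X \<rightarrow> topspace (Euclidean_space d)"
      and conv: "\<forall>x\<in>K. \<forall>y\<in>K. \<forall>u\<ge>0. \<forall>v\<ge>0. u + v = 1 \<longrightarrow> (\<lambda>i. u * x i + v * y i) \<in> K"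
      and rad_fin: "\<forall>A. finite A \<and> A \<subseteq> X \<longrightarrow> \<delta> A = circumradius d (\<phi> ` A) K"
      unfolding Minkowski_embeddable_def convex_body_def by (elim exE conjE) rule
    have rad: "\<delta> A = circumradius d (\<phi> ` A) K" if "A \<subseteq> X" for A
      using rad_fin finite_subset[OF that X(2)] that by simp
    have whole: "circumradius d (\<phi> ` X) K = 2"
      using rad[of X] X by (simp add: \<delta>_def)
    have facet: "circumradius d (\<phi> ` (X - {j})) K = 1" if "j \<in> X" for j
      using rad[of "X - {j}"] X that by (simp add: \<delta>_def)
    show False
    proof (cases "\<forall>j\<in>X. \<exists>l\<ge>0. \<exists>x\<in>topspace (Euclidean_space d).
        \<phi> ` (X - {j}) \<subseteq> scale_translate l K x")
      case True
      \<comment> \<open>For \<open>n = 4\<close> the factor is 3/8, so four facets of radius 1 would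
        give \<open>2 \<le> 3/2\<close>.\<close>
      then show False
        using circumradius_le_facets[OF conv X(2,1) _ \<phi>] whole facet X by auto
    next
      case False
      then obtain j where j: "j \<in> X" and empty: "\<And>l x. 0 \<le> l \<Longrightarrow>
          x \<in> topspace (Euclidean_space d) \<Longrightarrow> \<not> \<phi> ` (X - {j}) \<subseteq> scale_translate l K x"
        by blast
      \<comment> \<open>Both radii are the same junk value \<open>Inf {}\<close>, so the interior of \<open>K\<close> is not needed here.\<close>
      have "\<And>l x. 0 \<le> l \<Longrightarrow> x \<in> topspace (Euclidean_space d) \<Longrightarrow>
          \<not> \<phi> ` X \<subseteq> scale_translate l K x"
        using empty by (meson Diff_subset image_mono subset_trans)
      then have "circumradius d (\<phi> ` X) K = circumradius d (\<phi> ` (X - {j})) K"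
        unfolding circumradius_def using empty by (intro arg_cong[where f = Inf]) blast
      then show False
        using whole facet[OF j] by simp
    qed
  qed
  then show ?thesis
    using diversity_of_card_four[OF X(1)] X unfolding \<delta>_def by blast
qed

end
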